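(* Let $n$ be a positive integer and let $D_{2n}=\langle r,s\rangle$ be the dihedral group of order $2n$. (i) If $n$ is odd, then $D_{2n}$ has no equal covering. (ii) If $n$ is even, then $D_{2n}$ has the equal covering $\Pi=\{\langle r\rangle,\langle r^2,s\rangle,\langle r^2,rs\rangle\}$; consequently, $\sigma(D_{2n})=3$ for even $n$.
   Context: $D_{2n}=\langle r,s\rangle$ denotes the dihedral group of order $2n$, with defining relations $r^n=s^2=1$ and $srs=r^{-1}$. A covering of a group $G$ is a collection of proper subgroups of $G$ whose set-theoretic union is $G$. An equal covering of $G$ is a covering of $G$ all of whose members have the same order. $\sigma(G)$ denotes the smallest cardinality of any covering of $G$, with $\sigma(G)=\infty$ if $G$ has no covering. *)

theory Defs
  imports "HOL-Algebra.Algebra" "HOL-Library.Extended_Nat"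
begin

(* The relations alone bound the order by 2n; together with the order being 2n and r, s
   generating G they are therefore defining relations. For n = 1, 2 the group is abelian
   (cyclic of order two, respectively the Klein four-group). *)
locale dihedral_group = group G for G (structure) +
  fixes n :: nat and r s :: 'a
  assumes r_in_carrier: "r \<in> carrier G"
    and s_in_carrier: "s \<in> carrier G"
    and generated: "carrier G = generate G {r, s}"
    and r_pow: "r [^] n = \<one>"
    and s_pow: "s [^] (2::nat) = \<one>"
    and conj_rel: "s \<otimes> r \<otimes> s = inv r"
    and order_eq: "order G = 2 * n"

definition covering :: "('a, 'b) monoid_scheme \<Rightarrow> 'a set set \<Rightarrow> bool" where
  "covering G C \<longleftrightarrow> (\<forall>H\<in>C. subgroup H G \<and> H \<subset> carrier G) \<and> \<Union>C = carrier G"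

definition equal_covering :: "('a, 'b) monoid_scheme \<Rightarrow> 'a set set \<Rightarrow> bool" where
  "equal_covering G C \<longleftrightarrow> covering G C \<and> (\<forall>H\<in>C. \<forall>K\<in>C. card H = card K)"

(* The infimum over the empty set is infinity, which is the value for a group without covering.
   Infinite cardinalities, irrelevant for finite groups, are all identified with infinity. *)
definition covering_number :: "('a, 'b) monoid_scheme \<Rightarrow> enat" where
  "covering_number G = (INF C\<in>{C. covering G C}. if finite C then enat (card C) else \<infinity>)"

(* The pair (i, b) stands for the element r^i s^b. *)
definition dihedral_model :: "nat \<Rightarrow> (int \<times> bool) monoid" where
  "dihedral_model n =
    \<lparr>carrier = {0..<int n} \<times> UNIV,
     monoid.mult = (\<lambda>(i, b) (j, c). ((if b then i - j else i + j) mod int n, b \<noteq> c)),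
     one = (0, False)\<rparr>"

lemma dihedral_model_dihedral_group:
  assumes "n > 0"
  shows "dihedral_group (dihedral_model n) n (1 mod int n, False) (0, True)"
proof -
  let ?G = "dihedral_model n" and ?r = "(1 mod int n, False)" and ?s = "(0::int, True)"
  have n: "int n > 0" using assms by simp
  have mult: "(i, b) \<otimes>\<^bsub>?G\<^esub> (j, c) = ((if b then i - j else i + j) mod int n, b \<noteq> c)" for i j b c
    by (simp add: dihedral_model_def)
  have one: "\<one>\<^bsub>?G\<^esub> = (0, False)" by (simp add: dihedral_model_def)
  have carr: "carrier ?G = {0..<int n} \<times> UNIV" by (simp add: dihedral_model_def)
  interpret group ?G
  proof (rule groupI)
    fix x y z assume "x \<in> carrier ?G" "y \<in> carrier ?G" "z \<in> carrier ?G"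
    show "x \<otimes>\<^bsub>?G\<^esub> y \<otimes>\<^bsub>?G\<^esub> z = x \<otimes>\<^bsub>?G\<^esub> (y \<otimes>\<^bsub>?G\<^esub> z)"
      by (cases x; cases y; cases z) (auto simp: mult mod_simps algebra_simps)
  next
    fix x assume x: "x \<in> carrier ?G"
    obtain i b where [simp]: "x = (i, b)" by (cases x)
    have "(if b then i else (- i) mod int n, b) \<in> carrier ?G"
      using x n by (auto simp: carr)
    moreover have "(if b then i else (- i) mod int n, b) \<otimes>\<^bsub>?G\<^esub> x = \<one>\<^bsub>?G\<^esub>"
      by (auto simp: mult one mod_simps)
    ultimately show "\<exists>y\<in>carrier ?G. y \<otimes>\<^bsub>?G\<^esub> x = \<one>\<^bsub>?G\<^esub>" by blast
  qed (use n in \<open>auto simp: carr mult one\<close>)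
  have r: "?r \<in> carrier ?G" and s: "?s \<in> carrier ?G" using n by (auto simp: carr)
  have pow: "?r [^]\<^bsub>?G\<^esub> k = (int k mod int n, False)" for k :: nat
    by (induction k) (auto simp: one mult mod_simps algebra_simps)
  have gen: "x \<in> generate ?G {?r, ?s}" if x_in: "x \<in> carrier ?G" for x
  proof -
    obtain i b where x: "x = (i, b)" "0 \<le> i" "i < int n" using x_in by (cases x) (auto simp: carr)
    have rk: "?r [^]\<^bsub>?G\<^esub> k \<in> generate ?G {?r, ?s}" for k :: nat
      by (induction k) (auto intro: generate.intros)
    have i: "?r [^]\<^bsub>?G\<^esub> nat i = (i, False)" using x by (simp add: pow)
    show ?thesis
    proof (cases b)
      case True
      have "x = ?r [^]\<^bsub>?G\<^esub> nat i \<otimes>\<^bsub>?G\<^esub> ?s" using x True by (simp add: i mult)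
      then show ?thesis using rk by (auto intro: generate.intros)
    next
      case False
      then show ?thesis using rk[of "nat i"] x i by simp
    qed
  qed
  show ?thesis
  proof
    show "carrier ?G = generate ?G {?r, ?s}"
      using gen generate_incl[of "{?r, ?s}"] r s by auto
    show "?r [^]\<^bsub>?G\<^esub> n = \<one>\<^bsub>?G\<^esub>" by (simp add: pow one)
    show "?s [^]\<^bsub>?G\<^esub> (2::nat) = \<one>\<^bsub>?G\<^esub>" by (simp add: numeral_2_eq_2 one mult)
    have "?s \<otimes>\<^bsub>?G\<^esub> ?r \<otimes>\<^bsub>?G\<^esub> ?s \<otimes>\<^bsub>?G\<^esub> ?r = \<one>\<^bsub>?G\<^esub>"
      by (auto simp: mult one mod_simps)
    then show "?s \<otimes>\<^bsub>?G\<^esub> ?r \<otimes>\<^bsub>?G\<^esub> ?s = inv\<^bsub>?G\<^esub> ?r"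
      using r s by (metis inv_equality m_closed)
    show "order ?G = 2 * n"
      by (simp add: order_def carr card_cartesian_product)
  qed (fact r s)+
qed

end

theory Submission
  imports Defs
begin

text \<open>
  Counting shows that the \<open>2n\<close> expressions \<open>r\<^sup>i s\<^sup>b\<close> with \<open>0 \<le> i < n\<close> are distinct, so for even \<open>n\<close>
  the parity of \<open>i\<close> is well defined and the three given subgroups are the kernels of the
  homomorphisms \<open>b\<close>, \<open>i\<close> and \<open>i + b\<close> to the group of order two. Three of them suffice because one
  of \<open>b\<close>, \<open>i\<close>, \<open>i + b\<close> is always even, and two proper subgroups never cover a group. In any
  covering the member containing \<open>r\<close> has order \<open>n\<close>, whereas the member containing the involution
  \<open>s\<close> has even order; for odd \<open>n\<close> these cannot agree.
\<close>

section \<open>Subgroups of index two, and coverings with few members\<close>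

context group
begin

text \<open>By Lagrange the index times \<open>card H\<close> is the order; the bound makes the
  index at most two, and properness excludes index one.\<close>

lemma proper_subgroup_card_half:
  assumes "subgroup H G" "H \<noteq> carrier G" "finite (carrier G)" "order G \<le> 2 * card H"
  shows "2 * card H = order G"
proof -
  let ?k = "card (rcosets H)"
  have k: "?k * card H = order G"
    by (rule lagrange[OF assms(1)])
  have "card H < order G"
    using assms(1-3) subgroup.subset unfolding order_def by (metis psubset_card_mono psubsetI)
  with k have pos: "card H > 0" and "?k \<noteq> 0" "?k \<noteq> 1"
    using assms(4) by (auto intro: gr0I)
  moreover have "?k \<le> 2"
    using k assms(4) pos by (metis mult_le_cancel2)
  ultimately have "?k = 2" by linarith
  with k show ?thesis by simp
qed

text \<open>Supplies the bound that \<open>proper_subgroup_card_half\<close> asks for: a translate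
  is no larger than \<open>H\<close> itself.\<close>

lemma order_le_twice_card:
  assumes "H \<subseteq> carrier G" "finite (carrier G)" "carrier G \<subseteq> H \<union> (\<lambda>h. x \<otimes> h) ` H"
  shows "order G \<le> 2 * card H"
proof -
  have fin: "finite H" using assms(1,2) by (rule finite_subset)
  have "order G \<le> card (H \<union> (\<lambda>h. x \<otimes> h) ` H)"
    unfolding order_def using assms(3) fin by (intro card_mono) auto
  also have "\<dots> \<le> card H + card ((\<lambda>h. x \<otimes> h) ` H)" by (rule card_Un_le)
  also have "\<dots> \<le> card H + card H" using fin by (simp add: card_image_le)
  finally show ?thesis by simp
qed

lemma subgroup_pow_card:
  assumes "subgroup H G" "finite H" "x \<in> H"
  shows "x [^] card H = \<one>"
proof -
  interpret H: group "G\<lparr>carrier := H\<rparr>" by (rule subgroup_imp_group[OF assms(1)])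
  have "x [^]\<^bsub>G\<lparr>carrier := H\<rparr>\<^esub> order (G\<lparr>carrier := H\<rparr>) = \<one>\<^bsub>G\<lparr>carrier := H\<rparr>\<^esub>"
    using assms(3) by (intro H.pow_order_eq_1) simp
  then show ?thesis by (simp add: order_def nat_pow_consistent[symmetric])
qed

text \<open>Take \<open>x\<close> only in \<open>K\<close> and \<open>y\<close> only in
  \<open>H\<close>. If their product were in \<open>H\<close>, cancelling \<open>y\<close> would put
  \<open>x\<close> in \<open>H\<close>; if in \<open>K\<close>, cancelling \<open>x\<close> would
  put \<open>y\<close> in \<open>K\<close>.\<close>

lemma union_two_subgroups_not_carrier:
  assumes H: "subgroup H G" "H \<subset> carrier G" and K: "subgroup K G" "K \<subset> carrier G"
  shows "H \<union> K \<noteq> carrier G"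
proof
  assume un: "H \<union> K = carrier G"
  from H(2) un obtain x where x: "x \<in> K" "x \<notin> H" "x \<in> carrier G" by blast
  from K(2) un obtain y where y: "y \<in> H" "y \<notin> K" "y \<in> carrier G" by blast
  have "x \<otimes> y \<in> H \<union> K" using un x y by simp
  moreover have "x = x \<otimes> y \<otimes> inv y" using x y by (simp add: m_assoc)
  moreover have "y = inv x \<otimes> (x \<otimes> y)" using x y by (simp flip: m_assoc)
  ultimately show False
    using x y subgroup.m_closed[OF H(1)] subgroup.m_closed[OF K(1)]
      subgroup.m_inv_closed[OF H(1)] subgroup.m_inv_closed[OF K(1)] by (metis UnE)
qed

text \<open>Infinite coverings contribute infinity. Among finite ones, the empty family misses the
  identity, one proper subgroup is not everything, and two never suffice.\<close>

lemma covering_number_ge_3: "covering_number G \<ge> 3"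
  unfolding covering_number_def
proof (rule INF_greatest)
  fix C assume "C \<in> {C. covering G C}"
  then have C: "\<And>H. H \<in> C \<Longrightarrow> subgroup H G \<and> H \<subset> carrier G" "\<Union>C = carrier G"
    by (auto simp: covering_def)
  have "card C \<ge> 3" if fin: "finite C"
  proof (rule ccontr)
    assume "\<not> card C \<ge> 3"
    then consider "card C = 0" | "card C = 1" | "card C = 2" by linarith
    then show False
    proof cases
      case 1
      then show False using fin C(2) one_closed by auto
    next
      case 2
      then obtain H where "C = {H}" by (auto simp: card_1_singleton_iff)
      then show False using C by auto
    next
      case 3
      then obtain H K where "C = {H, K}" by (auto simp: card_2_iff)
      then show False using C union_two_subgroups_not_carrier[of H K] by auto
    qed
  qed
  then show "3 \<le> (if finite C then enat (card C) else \<infinity>)"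
    by (simp add: numeral_eq_enat)
qed

end

section \<open>The normal form of elements and its arithmetic\<close>

context dihedral_group
begin

text \<open>All integer exponents are allowed, so products and inverses involve no reduction modulo
  \<open>n\<close>.\<close>

definition elt :: "int \<Rightarrow> bool \<Rightarrow> 'a" where
  "elt i b = r [^] i \<otimes> (if b then s else \<one>)"

lemma elt_closed [simp]: "elt i b \<in> carrier G"
  using r_in_carrier s_in_carrier by (simp add: elt_def)

lemma elt_0_False: "elt 0 False = \<one>"
  by (simp add: elt_def)

lemma elt_1_False: "elt 1 False = r"
  using r_in_carrier by (simp add: elt_def)

lemma elt_0_True: "elt 0 True = s"
  using s_in_carrier by (simp add: elt_def)

lemma s_s: "s \<otimes> s = \<one>"
  using s_pow s_in_carrier by (simp add: numeral_2_eq_2)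

text \<open>Since \<open>s\<close> is an involution, conjugation by it is an endomorphism, so the
  relation for \<open>r\<close> passes to every power of \<open>r\<close>.\<close>

lemma s_r_pow: "s \<otimes> r [^] i = r [^] (- i) \<otimes> s" for i :: int
proof -
  note [simp] = r_in_carrier s_in_carrier
  have ss: "s \<otimes> (s \<otimes> x) = x" if "x \<in> carrier G" for x
    using that by (simp add: s_s flip: m_assoc)
  have "(\<lambda>x. s \<otimes> x \<otimes> s) \<in> hom G G"
    by (auto simp: hom_def m_assoc ss)
  then have "s \<otimes> r [^] i \<otimes> s = (s \<otimes> r \<otimes> s) [^] i"
    by (rule hom_int_pow) (auto simp: is_group)
  also have "\<dots> = r [^] (- i)"
    by (simp add: conj_rel int_pow_inv int_pow_neg)
  finally have "s \<otimes> r [^] i \<otimes> s \<otimes> s = r [^] (- i) \<otimes> s" by simp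
  then show ?thesis by (simp add: m_assoc s_s)
qed

lemma elt_mult: "elt i b \<otimes> elt j c = elt (if b then i - j else i + j) (b \<noteq> c)"
proof -
  note [simp] = r_in_carrier s_in_carrier
  have "s \<otimes> (r [^] j \<otimes> x) = r [^] (- j) \<otimes> (s \<otimes> x)" if "x \<in> carrier G" for x
    using that by (simp add: s_r_pow flip: m_assoc)
  then show ?thesis
    by (auto simp: elt_def m_assoc s_s s_r_pow int_pow_mult diff_conv_add_uminus
        simp del: add_uminus_conv_diff)
qed

lemma elt_mult_s: "elt i False \<otimes> s = elt i True"
  using elt_mult[of i False 0 True] by (simp add: elt_0_True)

lemma s_mult_elt: "s \<otimes> elt i False = elt (- i) True"
  using elt_mult[of 0 True i False] by (simp add: elt_0_True)

lemma elt_inv: "inv (elt i b) = elt (if b then i else - i) b"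
  by (rule inv_equality) (simp_all add: elt_mult elt_0_False)

lemma r_mult_s: "r \<otimes> s = elt 1 True"
  using r_in_carrier by (simp add: elt_def)

lemma r_squared: "r [^] (2::nat) = elt 2 False"
  using r_in_carrier by (simp add: elt_def flip: int_pow_int)

lemma r_squared_pow: "(r [^] (2::nat)) [^] k = elt (2 * k) False" for k :: int
  using r_in_carrier by (simp add: elt_def int_pow_pow flip: int_pow_int)

text \<open>The closure conditions mirror \<open>elt_mult\<close> and \<open>elt_inv\<close>,
  reducing subgroup proofs to parity arithmetic on exponents.\<close>

lemma subgroup_elt:
  assumes "P 0 False"
    and "\<And>i j b c. P i b \<Longrightarrow> P j c \<Longrightarrow> P (if b then i - j else i + j) (b \<noteq> c)"
    and "\<And>i b. P i b \<Longrightarrow> P (if b then i else - i) b"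
  shows "subgroup {elt i b | i b. P i b} G"
proof (rule subgroupI)
  show "{elt i b | i b. P i b} \<noteq> {}" using assms(1) by auto
  show "inv x \<in> {elt i b | i b. P i b}" if x: "x \<in> {elt i b | i b. P i b}" for x
  proof -
    obtain i b where "x = elt i b" "P i b" using x by blast
    then show ?thesis using assms(3) by (auto simp only: elt_inv)
  qed
  show "x \<otimes> y \<in> {elt i b | i b. P i b}"
    if xy: "x \<in> {elt i b | i b. P i b}" "y \<in> {elt i b | i b. P i b}" for x y
  proof -
    obtain i b j c where "x = elt i b" "P i b" "y = elt j c" "P j c" using xy by blast
    then have "x \<otimes> y = elt (if b then i - j else i + j) (b \<noteq> c)" "P (if b then i - j else i + j) (b \<noteq> c)"
      using assms(2) by (simp_all only: elt_mult)
    then show ?thesis by blast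
  qed
qed auto

lemma carrier_elt: "carrier G = {elt i b | i b. True}"
proof
  have "{r, s} \<subseteq> {elt i b | i b. True}"
    using elt_1_False elt_0_True by (auto intro: sym)
  then show "carrier G \<subseteq> {elt i b | i b. True}"
    unfolding generated by (rule generate_subgroup_incl) (rule subgroup_elt, auto)
qed auto

lemma elt_mod: "elt (i mod int n) b = elt i b"
proof -
  have "r [^] i = r [^] (int n * (i div int n) + i mod int n)" by simp
  also have "\<dots> = r [^] (i mod int n)"
    using r_in_carrier r_pow
    by (subst int_pow_mult) (simp_all add: int_pow_int flip: int_pow_pow)
  finally show ?thesis unfolding elt_def by (rule arg_cong[OF sym])
qed

section \<open>The three subgroups as conditions on exponents\<close>

lemma generate_r: "generate G {r} = {elt i b | i b. \<not> b}"
  proof -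
  have "elt i False = r [^] i" for i using r_in_carrier by (simp add: elt_def)
  then show ?thesis using r_in_carrier by (auto simp: generate_pow) metis
qed

text \<open>This holds for every \<open>n\<close>; for odd \<open>n\<close> both sides are the whole
  group, because there one element has exponents of both parities.\<close>

lemma generate_r2_s: "generate G {r [^] (2::nat), s} = {elt i b | i b. even i}" (is "?H = ?K")
proof
  have "{elt 2 False, elt 0 True} \<subseteq> ?K" by fastforce
  then have "{r [^] (2::nat), s} \<subseteq> ?K" by (simp only: r_squared elt_0_True)
  then show "?H \<subseteq> ?K"
    by (rule generate_subgroup_incl) (rule subgroup_elt, auto)
  have sub: "subgroup ?H G"
    using r_in_carrier s_in_carrier by (intro generate_is_subgroup) auto
  have "elt (2 * k) b \<in> ?H" for k b
  proof -
    have "elt (2 * k) b = (r [^] (2::nat)) [^] k \<otimes> (if b then s else \<one>)"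
      by (simp add: r_squared_pow elt_mult_s)
    moreover have "(r [^] (2::nat)) [^] k \<in> ?H"
      using sub by (intro subgroup_int_pow_closed) (auto intro: generate.incl)
    ultimately show ?thesis by (auto intro: generate.intros)
  qed
  then show "?K \<subseteq> ?H" by (auto elim!: evenE)
qed

lemma generate_r2_rs:
  "generate G {r [^] (2::nat), r \<otimes> s} = {elt i b | i b. even i \<longleftrightarrow> \<not> b}" (is "?H = ?K")
proof
  have "{r [^] (2::nat), r \<otimes> s} \<subseteq> ?K"
    unfolding r_squared r_mult_s by fastforce
  then show "?H \<subseteq> ?K"
    by (rule generate_subgroup_incl) (rule subgroup_elt, auto)
  have sub: "subgroup ?H G"
    using r_in_carrier s_in_carrier by (intro generate_is_subgroup) auto
  \<comment> \<open>The term \<open>of_bool b\<close> absorbs the extra \<open>r\<close> of the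
    generator \<open>r \<otimes> s\<close>, leaving an even power of \<open>r\<close> in
    front.\<close>
  have mem: "elt (2 * k + of_bool b) b \<in> ?H" for k b
  proof -
    have "elt (2 * k + of_bool b) b = (r [^] (2::nat)) [^] k \<otimes> (if b then r \<otimes> s else \<one>)"
      by (simp add: r_squared_pow r_mult_s elt_mult flip: elt_0_False)
    moreover have "(r [^] (2::nat)) [^] k \<in> ?H"
      using sub by (intro subgroup_int_pow_closed) (auto intro: generate.incl)
    ultimately show ?thesis by (auto intro: generate.intros)
  qed
  show "?K \<subseteq> ?H"
  proof
    fix x assume "x \<in> ?K"
    then obtain i b where x: "x = elt i b" "even i \<longleftrightarrow> \<not> b" by blast
    then have "i = 2 * (i div 2) + of_bool b" by (cases b) auto
    then show "x \<in> ?H" using mem[of "i div 2" b] x(1) by simp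
  qed
qed

section \<open>Uniqueness of the normal form, and the case of odd \<open>n\<close>\<close>

context
  assumes n_pos: "n > 0"
begin

lemma finite_carrier: "finite (carrier G)"
  using order_eq n_pos order_gt_0_iff_finite by simp

text \<open>The order hypothesis enters here, as the relations also hold in proper quotients. The
  reduced pairs map onto a carrier of the same finite size, so the map is injective.\<close>

lemma elt_eq_iff: "elt i b = elt j c \<longleftrightarrow> i mod int n = j mod int n \<and> b = c"
proof
  let ?I = "{0..<int n} \<times> (UNIV :: bool set)"
  have "carrier G \<subseteq> (\<lambda>(i, b). elt i b) ` ?I"
  proof
    fix x assume "x \<in> carrier G"
    then obtain i b where "x = elt (i mod int n) b" using carrier_elt elt_mod by auto
    then show "x \<in> (\<lambda>(i, b). elt i b) ` ?I"
      using n_pos by (intro image_eqI[of _ _ "(i mod int n, b)"]) auto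
  qed
  then have "card (carrier G) \<le> card ((\<lambda>(i, b). elt i b) ` ?I)"
    by (intro card_mono) auto
  moreover have "card ?I = card (carrier G)"
    using order_eq by (simp add: order_def card_cartesian_product)
  ultimately have inj: "inj_on (\<lambda>(i, b). elt i b) ?I"
    by (intro eq_card_imp_inj_on antisym card_image_le) auto
  assume "elt i b = elt j c"
  then have "elt (i mod int n) b = elt (j mod int n) c" by (simp add: elt_mod)
  then show "i mod int n = j mod int n \<and> b = c"
    using inj_onD[OF inj, of "(i mod int n, b)" "(j mod int n, c)"] n_pos by auto
next
  show "elt i b = elt j c" if "i mod int n = j mod int n \<and> b = c"
    using that elt_mod[of i b] elt_mod[of j c] by simp
qed

lemma s_neq_one: "s \<noteq> \<one>"
  using elt_eq_iff[of 0 True 0 False] by (simp add: elt_0_True elt_0_False)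

text \<open>Left translation by \<open>s\<close> carries the rotations onto the reflections.\<close>

lemma order_le_generate_r: "order G \<le> 2 * card (generate G {r})"
proof (rule order_le_twice_card[where x = s])
  have "elt i b \<in> generate G {r} \<union> (\<lambda>h. s \<otimes> h) ` generate G {r}" for i b
  proof (cases b)
    case True
    have "elt i b = s \<otimes> elt (- i) False" using True by (simp add: s_mult_elt)
    then show ?thesis by (auto simp: generate_r)
  qed (auto simp: generate_r)
  then show "carrier G \<subseteq> generate G {r} \<union> (\<lambda>h. s \<otimes> h) ` generate G {r}"
    by (auto simp: carrier_elt)
qed (use finite_carrier r_in_carrier generate_incl in auto)

lemma card_subgroup_containing_r:
  assumes "subgroup H G" "H \<subset> carrier G" "r \<in> H"
  shows "card H = n"
proof -
  have fin: "finite H" using assms(2) finite_carrier by (auto intro: finite_subset)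
  have "generate G {r} \<subseteq> H" using assms by (intro generate_subgroup_incl) auto
  then have "order G \<le> 2 * card H"
    using order_le_generate_r card_mono[OF fin, of "generate G {r}"] by simp
  then have "2 * card H = order G"
    using assms finite_carrier by (intro proper_subgroup_card_half) auto
  then show ?thesis by (simp add: order_eq)
qed

lemma odd_no_equal_covering:
  assumes "odd n"
  shows "\<not> equal_covering G C"
proof
  assume "equal_covering G C"
  then have sub: "\<And>H. H \<in> C \<Longrightarrow> subgroup H G \<and> H \<subset> carrier G" and un: "\<Union>C = carrier G"
    and eq: "\<And>H K. H \<in> C \<Longrightarrow> K \<in> C \<Longrightarrow> card H = card K"
    unfolding equal_covering_def covering_def by blast+
  obtain H where H: "H \<in> C" "r \<in> H" using un r_in_carrier by blast
  obtain K where K: "K \<in> C" "s \<in> K" using un s_in_carrier by blast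
  have "card K = n" using card_subgroup_containing_r[of H] H sub eq[OF H(1) K(1)] by simp
  then have "s [^] n = \<one>"
    using subgroup_pow_card[of K s] sub[OF K(1)] K(2) finite_carrier
    by (auto intro: finite_subset)
  \<comment> \<open>An odd power of the involution \<open>s\<close> is \<open>s\<close> itself, so
    \<open>s\<close> would be trivial.\<close>
  moreover obtain k where "n = 2 * k + 1" using assms by (rule oddE)
  ultimately have "s = \<one>"
    using s_in_carrier s_pow by (simp flip: nat_pow_pow)
  with s_neq_one show False by simp
qed

section \<open>The case of even \<open>n\<close>\<close>

context
  assumes n_even: "even n"
begin

text \<open>Reduction modulo an even \<open>n\<close> preserves parity.\<close>

lemma elt_eq_imp_parity: "elt i b = elt j c \<Longrightarrow> even i \<longleftrightarrow> even j"
  using n_even by (metis elt_eq_iff dvd_mod_iff even_of_nat)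

text \<open>Criterion for index two. The element \<open>elt k c\<close> witnesses properness, and
  the last assumption says that its inverse moves every element outside the subgroup into it.
  Dependence on the parity of \<open>i\<close> alone makes \<open>P\<close> well defined on
  elements.\<close>

lemma elt_subgroup_proper_card:
  assumes "subgroup {elt i b | i b. P i b} G"
    and "\<And>i j b. even i \<longleftrightarrow> even j \<Longrightarrow> P i b \<longleftrightarrow> P j b"
    and "\<not> P k c"
    and "\<And>i b. \<not> P i b \<Longrightarrow> P (if c then k - i else i - k) (b \<noteq> c)"
  shows "{elt i b | i b. P i b} \<subset> carrier G" "card {elt i b | i b. P i b} = n"
proof -
  let ?H = "{elt i b | i b. P i b}"
  have "elt k c \<notin> ?H"
  proof
    assume "elt k c \<in> ?H"
    then obtain i b where "elt k c = elt i b" "P i b" by blast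
    then show False
      using assms(2)[of k i c] assms(3) elt_eq_imp_parity[of k c i b] elt_eq_iff[of k c i b] by simp
  qed
  then show proper: "?H \<subset> carrier G" using subgroup.subset[OF assms(1)] elt_closed by blast
  have "elt i b \<in> ?H \<union> (\<lambda>h. elt k c \<otimes> h) ` ?H" for i b
  proof (cases "P i b")
    case False
    have "elt i b = elt k c \<otimes> elt (if c then k - i else i - k) (b \<noteq> c)"
      by (auto simp: elt_mult)
    then show ?thesis using assms(4)[OF False] by blast
  qed auto
  then have "order G \<le> 2 * card ?H"
    by (intro order_le_twice_card[where x = "elt k c"] finite_carrier) (auto simp: carrier_elt)
  then have "2 * card ?H = order G"
    using proper assms(1) finite_carrier by (intro proper_subgroup_card_half) auto
  then show "card ?H = n" by (simp add: order_eq)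
qed

lemma even_equal_covering:
  "equal_covering G
    {generate G {r}, generate G {r [^] (2::nat), s}, generate G {r [^] (2::nat), r \<otimes> s}}"
proof -
  have A: "subgroup {elt i b | i b. \<not> b} G" by (rule subgroup_elt) auto
  have B: "subgroup {elt i b | i b. even i} G" by (rule subgroup_elt) auto
  have C: "subgroup {elt i b | i b. even i \<longleftrightarrow> \<not> b} G" by (rule subgroup_elt) auto
  \<comment> \<open>The element outside the rotations is \<open>s\<close>; for the other two
    subgroups it is \<open>r\<close>.\<close>
  have A': "{elt i b | i b. \<not> b} \<subset> carrier G \<and> card {elt i b | i b. \<not> b} = n"
    using elt_subgroup_proper_card[where P = "\<lambda>i b. \<not> b" and k = 0 and c = True, OF A] by auto
  have B': "{elt i b | i b. even i} \<subset> carrier G \<and> card {elt i b | i b. even i} = n"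
    using elt_subgroup_proper_card[where P = "\<lambda>i b. even i" and k = 1 and c = False, OF B] by auto
  have C': "{elt i b | i b. even i \<longleftrightarrow> \<not> b} \<subset> carrier G \<and>
      card {elt i b | i b. even i \<longleftrightarrow> \<not> b} = n"
    using elt_subgroup_proper_card[where P = "\<lambda>i b. even i \<longleftrightarrow> \<not> b" and k = 1 and c = False, OF C] by auto
  \<comment> \<open>Rotations lie in the first set; a reflection lies in the second or third
    according to the parity of \<open>i\<close>.\<close>
  have "{elt i b | i b. \<not> b} \<union> {elt i b | i b. even i} \<union> {elt i b | i b. even i \<longleftrightarrow> \<not> b}
      = carrier G"
    unfolding carrier_elt by blast
  then show ?thesis
    unfolding equal_covering_def covering_def generate_r generate_r2_s generate_r2_rs
    using A B C A' B' C' by auto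
qed

lemma even_covering_number: "covering_number G = 3"
proof (rule antisym)
  let ?C = "{generate G {r}, generate G {r [^] (2::nat), s}, generate G {r [^] (2::nat), r \<otimes> s}}"
  \<comment> \<open>An upper bound is enough, since \<open>covering_number_ge_3\<close> gives the
    other inequality.\<close>
  have "card ?C \<le> 3" by (simp add: card_insert_if)
  then show "covering_number G \<le> 3"
    unfolding covering_number_def
    using even_equal_covering
    by (intro INF_lower2[of ?C]) (auto simp: equal_covering_def numeral_eq_enat)
qed (rule covering_number_ge_3)

end

end

end

theorem theorem14:
  fixes G (structure) and n :: nat
  assumes "n > 0"
    and "dihedral_group G n r s"
  shows "(odd n \<longrightarrow> \<not> (\<exists>C. equal_covering G C)) \<and>
    (even n \<longrightarrow>
      equal_covering G
        {generate G {r}, generate G {r [^] (2::nat), s}, generate G {r [^] (2::nat), r \<otimes> s}} \<and>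
      covering_number G = 3)"
  using dihedral_group.odd_no_equal_covering[OF assms(2,1)]
    dihedral_group.even_equal_covering[OF assms(2,1)]
    dihedral_group.even_covering_number[OF assms(2,1)]
  by blast

end
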